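(* Let $G=(V,E)$ be a finite undirected graph with $\kappa$ connected components. Then the normal form of the four-flow polynomial of $G$ is $$[f_G]=4^{\kappa}\cdot\sum_{\psi=(\psi_1,\psi_2):E\to\{(0,0),(0,1),(1,0)\}}c(\psi)\prod_{e\in E}x_e^{\psi_1(e)}y_e^{\psi_2(e)},$$ where $c(\psi)$ is the number of even $\psi$-conformal dual four-flows on $G$ minus the number of odd ones.
   Context: $\delta(v)$ is the set of edges incident to $v$. $f_G:=\prod_{v\in V}\Big(\prod_{e\in\delta(v)}x_e+1\Big)\Big(\prod_{e\in\delta(v)}y_e+1\Big)\in\mathbb{C}[x_e,y_e:e\in E]$, and $I_E:=\mathrm{ideal}\{x_e^2-1,\ y_e^2-1,\ (x_e+1)(y_e+1): e\in E\}$. Basic monomials are $\prod_{e}x_e^{\psi_1(e)}y_e^{\psi_2(e)}$ with $(\psi_1,\psi_2):E\to\{(0,0),(0,1),(1,0)\}$; their classes form a $\mathbb{C}$-basis of $\mathbb{C}[x,y]/I_E$, and the normal form $[f]$ of $f$ is the unique $\mathbb{C}$-linear combination of basic monomials with $f-[f]\in I_E$. A dual four-flow is a map $\phi:E\to\mathbb{Z}_2\times\mathbb{Z}_2$ such that the sum of $\phi(e)$ over the edges of every circuit of $G$ is $(0,0)$. A map $\phi:E\to\mathbb{Z}_2\times\mathbb{Z}_2$ is even if $|\phi^{-1}(1,1)|$ is even, odd otherwise. For $\psi:E\to\{(0,0),(0,1),(1,0)\}$, $\phi$ is $\psi$-conformal if $\phi(e)\in\{\psi(e),(1,1)\}$ for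 every edge $e$. *)

theory Defs
  imports Complex_Main
    "HOL-Library.FuncSet"
    "HOL-Library.Poly_Mapping"
    "HOL-Library.Product_Plus"
    "HOL-Library.Z2"
    "HOL-Algebra.Ideal"
begin

text \<open>
  Parallel edges are allowed, loops are not: since \<open>\<delta>(v)\<close> is a set, a loop would contribute its
  variable only once at its vertex, and the normal form theorem would fail
  (for one vertex with one loop, \<open>(x + 1) (y + 1)\<close> lies in the ideal).
\<close>

locale finite_graph =
  fixes V :: "'v set" and E :: "'e set" and ends :: "'e \<Rightarrow> 'v set"
  assumes finite_V: "finite V"
    and finite_E: "finite E"
    and ends_subset: "e \<in> E \<Longrightarrow> ends e \<subseteq> V"
    and card_ends: "e \<in> E \<Longrightarrow> card (ends e) = 2"

definition incident_edges :: "'e set \<Rightarrow> ('e \<Rightarrow> 'v set) \<Rightarrow> 'v \<Rightarrow> 'e set" where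
  "incident_edges E ends v = {e \<in> E. v \<in> ends e}"

definition adjacency :: "'e set \<Rightarrow> ('e \<Rightarrow> 'v set) \<Rightarrow> ('v \<times> 'v) set" where
  "adjacency E ends = {(u, v). \<exists>e\<in>E. ends e = {u, v}}"

definition connected_components :: "'v set \<Rightarrow> 'e set \<Rightarrow> ('e \<Rightarrow> 'v set) \<Rightarrow> 'v set set" where
  "connected_components V E ends = V // ((adjacency E ends)\<^sup>* \<inter> V \<times> V)"

definition num_components :: "'v set \<Rightarrow> 'e set \<Rightarrow> ('e \<Rightarrow> 'v set) \<Rightarrow> nat" where
  "num_components V E ends = card (connected_components V E ends)"

text \<open>The edge sets of circuits; two parallel edges form a circuit of length 2.\<close>

definition is_circuit :: "'e set \<Rightarrow> ('e \<Rightarrow> 'v set) \<Rightarrow> 'e set \<Rightarrow> bool" where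
  "is_circuit E ends C \<longleftrightarrow>
     (\<exists>vs es. length vs = length es \<and> 2 \<le> length es \<and> distinct vs \<and> distinct es \<and>
        C = set es \<and> C \<subseteq> E \<and>
        (\<forall>i < length es. ends (es ! i) = {vs ! i, vs ! (Suc i mod length es)}))"

definition dual_four_flows :: "'e set \<Rightarrow> ('e \<Rightarrow> 'v set) \<Rightarrow> ('e \<Rightarrow> bit \<times> bit) set" where
  "dual_four_flows E ends =
     {\<phi> \<in> E \<rightarrow>\<^sub>E UNIV. \<forall>C. is_circuit E ends C \<longrightarrow> (\<Sum>e\<in>C. \<phi> e) = (0, 0)}"

definition even_map :: "'e set \<Rightarrow> ('e \<Rightarrow> bit \<times> bit) \<Rightarrow> bool" where
  "even_map E \<phi> \<longleftrightarrow> even (card {e \<in> E. \<phi> e = (1, 1)})"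

definition conformal :: "'e set \<Rightarrow> ('e \<Rightarrow> bit \<times> bit) \<Rightarrow> ('e \<Rightarrow> bit \<times> bit) \<Rightarrow> bool" where
  "conformal E \<psi> \<phi> \<longleftrightarrow> (\<forall>e\<in>E. \<phi> e \<in> {\<psi> e, (1, 1)})"

definition basic_maps :: "'e set \<Rightarrow> ('e \<Rightarrow> bit \<times> bit) set" where
  "basic_maps E = E \<rightarrow>\<^sub>E {(0, 0), (0, 1), (1, 0)}"

definition flow_coeff :: "'e set \<Rightarrow> ('e \<Rightarrow> 'v set) \<Rightarrow> ('e \<Rightarrow> bit \<times> bit) \<Rightarrow> int" where
  "flow_coeff E ends \<psi> =
     int (card {\<phi> \<in> dual_four_flows E ends. conformal E \<psi> \<phi> \<and> even_map E \<phi>}) -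
     int (card {\<phi> \<in> dual_four_flows E ends. conformal E \<psi> \<phi> \<and> \<not> even_map E \<phi>})"

datatype 'e flow_var = XVar 'e | YVar 'e

type_synonym 'e flow_poly = "('e flow_var \<Rightarrow>\<^sub>0 nat) \<Rightarrow>\<^sub>0 complex"

definition Var :: "'e flow_var \<Rightarrow> 'e flow_poly" where
  "Var z = Poly_Mapping.single (Poly_Mapping.single z 1) 1"

definition Const :: "complex \<Rightarrow> 'e flow_poly" where
  "Const a = Poly_Mapping.single 0 a"

abbreviation xp :: "'e \<Rightarrow> 'e flow_poly" where "xp e \<equiv> Var (XVar e)"
abbreviation yp :: "'e \<Rightarrow> 'e flow_poly" where "yp e \<equiv> Var (YVar e)"

text \<open>
  The ring \<open>\<complex>[x\<^sub>e, y\<^sub>e : e \<in> E]\<close>. The type of polynomials has variables for all edges of the type,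
  so the carrier consists of the polynomials in which only variables indexed by \<open>E\<close> occur.
\<close>

definition flow_poly_ring :: "'e set \<Rightarrow> 'e flow_poly ring" where
  "flow_poly_ring E =
     \<lparr>carrier = {p. \<forall>m \<in> Poly_Mapping.keys p. Poly_Mapping.keys m \<subseteq> XVar ` E \<union> YVar ` E},
      monoid.mult = (*), one = 1, zero = 0, add = (+)\<rparr>"

definition edge_ideal :: "'e set \<Rightarrow> 'e flow_poly set" where
  "edge_ideal E =
     genideal (flow_poly_ring E)
       (\<Union>e\<in>E. {(xp e)\<^sup>2 - 1, (yp e)\<^sup>2 - 1, (xp e + 1) * (yp e + 1)})"

definition basic_monomial :: "'e set \<Rightarrow> ('e \<Rightarrow> bit \<times> bit) \<Rightarrow> 'e flow_poly" where
  "basic_monomial E \<psi> = (\<Prod>e\<in>E. xp e ^ of_bit (fst (\<psi> e)) * yp e ^ of_bit (snd (\<psi> e)))"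

definition basic_combinations :: "'e set \<Rightarrow> 'e flow_poly set" where
  "basic_combinations E =
     {g. \<exists>a. g = (\<Sum>\<psi>\<in>basic_maps E. Const (a \<psi>) * basic_monomial E \<psi>)}"

definition normal_form :: "'e set \<Rightarrow> 'e flow_poly \<Rightarrow> 'e flow_poly" where
  "normal_form E f = (THE g. g \<in> basic_combinations E \<and> f - g \<in> edge_ideal E)"

definition four_flow_poly :: "'v set \<Rightarrow> 'e set \<Rightarrow> ('e \<Rightarrow> 'v set) \<Rightarrow> 'e flow_poly" where
  "four_flow_poly V E ends =
     (\<Prod>v\<in>V. ((\<Prod>e\<in>incident_edges E ends v. xp e) + 1) *
            ((\<Prod>e\<in>incident_edges E ends v. yp e) + 1))"

end

theory Submission
  imports Defs
begin

text \<open>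
  Expanding the product over the vertices writes \<open>f\<^sub>G\<close> as a sum over all potentials
  \<open>h : V \<rightarrow> \<int>\<^sub>2 \<times> \<int>\<^sub>2\<close>; modulo \<open>x\<^sub>e\<^sup>2 - 1\<close> and \<open>y\<^sub>e\<^sup>2 - 1\<close> the term of \<open>h\<close> is the monomial with
  exponents the coboundary of \<open>h\<close>. The coboundaries are the dual four-flows, and each of them comes
  from \<open>4\<^sup>\<kappa>\<close> potentials, which differ by functions constant on components. Finally
  \<open>x\<^sub>e y\<^sub>e \<equiv> - 1 - x\<^sub>e - y\<^sub>e\<close> distributes the monomial of a flow \<open>\<phi>\<close>, with sign
  \<open>(-1)\<^bsup>|\<phi>\<^sup>-\<^sup>1(1,1)|\<^esup>\<close>, over the \<open>\<psi>\<close> to which it conforms. Uniqueness of the normal form holds since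
  basic monomials are linearly independent as functions on the common zeros of the ideal.
\<close>

subsection \<open>Evaluation of polynomials\<close>

lemma poly_mapping_single_sum:
  "(\<Sum>k\<in>Poly_Mapping.keys p. Poly_Mapping.single k (Poly_Mapping.lookup p k)) = p"
  by (rule poly_mapping_eqI)
    (auto simp: lookup_sum lookup_single when_def in_keys_iff)

definition monomial_value :: "('x \<Rightarrow> complex) \<Rightarrow> ('x \<Rightarrow>\<^sub>0 nat) \<Rightarrow> complex" where
  "monomial_value s m = (\<Prod>z\<in>Poly_Mapping.keys m. s z ^ Poly_Mapping.lookup m z)"

text \<open>Evaluation at the point \<open>s\<close>. It is a ring homomorphism, so its values at a
  common zero of an ideal depend only on residue classes.\<close>

definition poly_value :: "('x \<Rightarrow> complex) \<Rightarrow> (('x \<Rightarrow>\<^sub>0 nat) \<Rightarrow>\<^sub>0 complex) \<Rightarrow> complex" where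
  "poly_value s p = (\<Sum>m\<in>Poly_Mapping.keys p. Poly_Mapping.lookup p m * monomial_value s m)"

text \<open>Additional variables have exponent 0 and contribute the factor 1, so several monomials
  can be compared over one common set of variables.\<close>

lemma monomial_value_superset:
  assumes "finite A" "Poly_Mapping.keys m \<subseteq> A"
  shows "monomial_value s m = (\<Prod>z\<in>A. s z ^ Poly_Mapping.lookup m z)"
  unfolding monomial_value_def
  by (rule prod.mono_neutral_left) (use assms in \<open>auto simp: in_keys_iff\<close>)

lemma monomial_value_zero [simp]: "monomial_value s 0 = 1"
  by (simp add: monomial_value_def)

lemma monomial_value_add: "monomial_value s (m + n) = monomial_value s m * monomial_value s n"
proof -
  let ?A = "Poly_Mapping.keys m \<union> Poly_Mapping.keys n"
  have "monomial_value s k = (\<Prod>z\<in>?A. s z ^ Poly_Mapping.lookup k z)" if "k \<in> {m + n, m, n}" for k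
    by (rule monomial_value_superset) (use that keys_add[of m n] in auto)
  then show ?thesis
    by (simp add: lookup_add power_add prod.distrib)
qed

lemma poly_value_zero [simp]: "poly_value s 0 = 0"
  by (simp add: poly_value_def)

lemma poly_value_single [simp]: "poly_value s (Poly_Mapping.single m a) = a * monomial_value s m"
  by (simp add: poly_value_def)

lemma poly_value_add [simp]: "poly_value s (p + q) = poly_value s p + poly_value s q"
  unfolding poly_value_def
  by (rule setsum_keys_plus_distrib) (simp_all add: algebra_simps)

lemma poly_value_sum [simp]: "poly_value s (sum p A) = (\<Sum>x\<in>A. poly_value s (p x))"
  by (induction A rule: infinite_finite_induct) simp_all

lemma poly_value_diff [simp]: "poly_value s (p - q) = poly_value s p - poly_value s q"
  using poly_value_add[of s "p - q" q] by simp

lemma poly_value_one [simp]: "poly_value s 1 = 1"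
  using poly_value_single[of s 0 1] by (simp del: poly_value_single)

lemma poly_value_mult [simp]: "poly_value s (p * q) = poly_value s p * poly_value s q"
proof -
  let ?t = "\<lambda>p k. Poly_Mapping.single k (Poly_Mapping.lookup p k)"
  \<comment> \<open>Both factors are split into single terms, for which multiplicativity is
    \<open>monomial_value_add\<close>.\<close>
  have "p * q = (\<Sum>k\<in>Poly_Mapping.keys p. ?t p k) * (\<Sum>l\<in>Poly_Mapping.keys q. ?t q l)"
    by (simp add: poly_mapping_single_sum)
  also have "\<dots> = (\<Sum>k\<in>Poly_Mapping.keys p. \<Sum>l\<in>Poly_Mapping.keys q.
      Poly_Mapping.single (k + l) (Poly_Mapping.lookup p k * Poly_Mapping.lookup q l))"
    by (simp add: sum_product mult_single)
  finally show ?thesis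
    by (simp add: monomial_value_add sum_product) (simp add: poly_value_def sum_product mult_ac)
qed

lemma poly_value_power [simp]: "poly_value s (p ^ n) = poly_value s p ^ n"
  by (induction n) simp_all

lemma poly_value_prod [simp]: "poly_value s (prod p A) = (\<Prod>x\<in>A. poly_value s (p x))"
  by (induction A rule: infinite_finite_induct) simp_all

lemma poly_value_Var [simp]: "poly_value s (Var z) = s z"
  by (simp add: Var_def monomial_value_def)

lemma poly_value_Const [simp]: "poly_value s (Const a) = a"
  by (simp add: Const_def)

subsection \<open>The edge ideal\<close>

text \<open>The ideal is generated inside the ring in the variables of \<open>E\<close>, so
  cofactors must lie in this carrier; the closure rules that follow certify this.\<close>

lemma carrier_iff:
  "p \<in> carrier (flow_poly_ring E) \<longleftrightarrow>
    (\<forall>m\<in>Poly_Mapping.keys p. Poly_Mapping.keys m \<subseteq> XVar ` E \<union> YVar ` E)"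
  by (simp add: flow_poly_ring_def)

lemma carrier_zero: "0 \<in> carrier (flow_poly_ring E)"
  and carrier_one: "1 \<in> carrier (flow_poly_ring E)"
  by (simp_all add: carrier_iff)

lemma carrier_Var: "e \<in> E \<Longrightarrow> xp e \<in> carrier (flow_poly_ring E)"
  "e \<in> E \<Longrightarrow> yp e \<in> carrier (flow_poly_ring E)"
  by (simp_all add: carrier_iff Var_def)

lemma carrier_Const: "Const a \<in> carrier (flow_poly_ring E)"
  by (simp add: carrier_iff Const_def)

lemma carrier_add:
  "p \<in> carrier (flow_poly_ring E) \<Longrightarrow> q \<in> carrier (flow_poly_ring E) \<Longrightarrow>
    p + q \<in> carrier (flow_poly_ring E)"
  using keys_add[of p q] by (auto simp: carrier_iff)

lemma carrier_uminus:
  "p \<in> carrier (flow_poly_ring E) \<Longrightarrow> - p \<in> carrier (flow_poly_ring E)"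
  by (auto simp: carrier_iff in_keys_iff)

lemma carrier_diff:
  "p \<in> carrier (flow_poly_ring E) \<Longrightarrow> q \<in> carrier (flow_poly_ring E) \<Longrightarrow>
    p - q \<in> carrier (flow_poly_ring E)"
  using carrier_add[OF _ carrier_uminus, of p E q] by simp

lemma carrier_mult:
  assumes "p \<in> carrier (flow_poly_ring E)" "q \<in> carrier (flow_poly_ring E)"
  shows "p * q \<in> carrier (flow_poly_ring E)"
  unfolding carrier_iff
proof
  fix m assume "m \<in> Poly_Mapping.keys (p * q)"
  then obtain a b where "m = a + b" "a \<in> Poly_Mapping.keys p" "b \<in> Poly_Mapping.keys q"
    using keys_mult[of p q] by blast
  then show "Poly_Mapping.keys m \<subseteq> XVar ` E \<union> YVar ` E"
    using assms keys_add[of a b] unfolding carrier_iff by blast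
qed

lemma carrier_power:
  "p \<in> carrier (flow_poly_ring E) \<Longrightarrow> p ^ n \<in> carrier (flow_poly_ring E)"
  by (induction n) (auto intro: carrier_one carrier_mult)

lemma carrier_sum:
  "(\<And>x. x \<in> A \<Longrightarrow> p x \<in> carrier (flow_poly_ring E)) \<Longrightarrow> sum p A \<in> carrier (flow_poly_ring E)"
  by (induction A rule: infinite_finite_induct) (auto intro: carrier_zero carrier_add)

lemma carrier_prod:
  "(\<And>x. x \<in> A \<Longrightarrow> p x \<in> carrier (flow_poly_ring E)) \<Longrightarrow> prod p A \<in> carrier (flow_poly_ring E)"
  by (induction A rule: infinite_finite_induct) (auto intro: carrier_one carrier_mult)

lemmas carrier_intros = carrier_zero carrier_one carrier_Var carrier_Const carrier_add
  carrier_uminus carrier_diff carrier_mult carrier_power carrier_sum carrier_prod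

lemma flow_poly_ring_simps [simp]:
  "p \<otimes>\<^bsub>flow_poly_ring E\<^esub> q = p * q" "p \<oplus>\<^bsub>flow_poly_ring E\<^esub> q = p + q"
  "\<one>\<^bsub>flow_poly_ring E\<^esub> = 1" "\<zero>\<^bsub>flow_poly_ring E\<^esub> = 0"
  by (simp_all add: flow_poly_ring_def)

lemma cring_flow_poly_ring: "cring (flow_poly_ring E)"
proof (rule cringI)
  show "abelian_group (flow_poly_ring E)"
  proof (rule abelian_groupI)
    fix p assume "p \<in> carrier (flow_poly_ring E)"
    then show "\<exists>q\<in>carrier (flow_poly_ring E). q \<oplus>\<^bsub>flow_poly_ring E\<^esub> p = \<zero>\<^bsub>flow_poly_ring E\<^esub>"
      by (intro bexI[of _ "- p"]) (auto intro: carrier_uminus)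
  qed (auto simp: add_ac intro: carrier_add carrier_zero)
  show "Group.comm_monoid (flow_poly_ring E)"
    by (rule comm_monoidI) (auto simp: mult_ac intro: carrier_mult carrier_one)
qed (simp add: distrib_right)

lemma ring_flow_poly_ring: "ring (flow_poly_ring E)"
  using cring_flow_poly_ring by (rule cring.axioms)

lemma edge_relations_subset_carrier:
  "(\<Union>e\<in>E. {(xp e)\<^sup>2 - 1, (yp e)\<^sup>2 - 1, (xp e + 1) * (yp e + 1)}) \<subseteq> carrier (flow_poly_ring E)"
  by (auto intro!: carrier_intros)

lemma ideal_edge_ideal: "ideal (edge_ideal E) (flow_poly_ring E)"
  unfolding edge_ideal_def
  by (rule ring.genideal_ideal[OF ring_flow_poly_ring edge_relations_subset_carrier])

lemma edge_relations_in_ideal: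
  assumes "e \<in> E"
  shows "(xp e)\<^sup>2 - 1 \<in> edge_ideal E" "(yp e)\<^sup>2 - 1 \<in> edge_ideal E"
    "(xp e + 1) * (yp e + 1) \<in> edge_ideal E"
proof -
  have "\<forall>e\<in>E. {(xp e)\<^sup>2 - 1, (yp e)\<^sup>2 - 1, (xp e + 1) * (yp e + 1)} \<subseteq> edge_ideal E"
    using ring.genideal_self[OF ring_flow_poly_ring edge_relations_subset_carrier]
    unfolding edge_ideal_def UN_subset_iff .
  then show "(xp e)\<^sup>2 - 1 \<in> edge_ideal E" "(yp e)\<^sup>2 - 1 \<in> edge_ideal E"
    "(xp e + 1) * (yp e + 1) \<in> edge_ideal E"
    using assms by simp_all
qed

lemma edge_ideal_zero: "0 \<in> edge_ideal E"
  using additive_subgroup.zero_closed[OF ideal.axioms(1)[OF ideal_edge_ideal, of E]]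
  by simp

lemma edge_ideal_add: "p \<in> edge_ideal E \<Longrightarrow> q \<in> edge_ideal E \<Longrightarrow> p + q \<in> edge_ideal E"
  using additive_subgroup.a_closed[OF ideal.axioms(1)[OF ideal_edge_ideal, of E]]
  by simp

lemma edge_ideal_mult:
  "p \<in> edge_ideal E \<Longrightarrow> q \<in> carrier (flow_poly_ring E) \<Longrightarrow> q * p \<in> edge_ideal E"
  using ideal.I_l_closed[OF ideal_edge_ideal, of p E q]
  by simp

section \<open>Congruence modulo the edge ideal\<close>

text \<open>Carrier membership of both sides is built in because the ideal absorbs only factors from
  the carrier; congruences can then be multiplied without side conditions.\<close>

definition flow_cong :: "'e set \<Rightarrow> 'e flow_poly \<Rightarrow> 'e flow_poly \<Rightarrow> bool" where
  "flow_cong E p q \<longleftrightarrow> p \<in> carrier (flow_poly_ring E) \<and> q \<in> carrier (flow_poly_ring E) \<and>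
     p - q \<in> edge_ideal E"

lemma flow_cong_refl: "p \<in> carrier (flow_poly_ring E) \<Longrightarrow> flow_cong E p p"
  by (simp add: flow_cong_def edge_ideal_zero)

lemma flow_cong_trans: "flow_cong E p q \<Longrightarrow> flow_cong E q r \<Longrightarrow> flow_cong E p r"
  using edge_ideal_add[of "p - q" E "q - r"] by (simp add: flow_cong_def)

lemma flow_cong_add:
  "flow_cong E p q \<Longrightarrow> flow_cong E p' q' \<Longrightarrow> flow_cong E (p + p') (q + q')"
  using edge_ideal_add[of "p - q" E "p' - q'"]
  by (auto simp: flow_cong_def algebra_simps intro: carrier_add)

lemma flow_cong_mult:
  assumes "flow_cong E p q" "flow_cong E p' q'"
  shows "flow_cong E (p * p') (q * q')"
proof -
  \<comment> \<open>Inserting the mixed term \<open>q * p'\<close> leaves carrier multiples of the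
    two given differences.\<close>
  have "p * p' - q * q' = p' * (p - q) + q * (p' - q')"
    by (simp add: algebra_simps)
  then show ?thesis
    using assms by (auto simp: flow_cong_def intro!: carrier_mult edge_ideal_add edge_ideal_mult)
qed

lemma flow_cong_sum:
  "(\<And>x. x \<in> A \<Longrightarrow> flow_cong E (p x) (q x)) \<Longrightarrow> flow_cong E (sum p A) (sum q A)"
  by (induction A rule: infinite_finite_induct)
    (auto intro: flow_cong_add flow_cong_refl carrier_zero)

lemma flow_cong_prod:
  "(\<And>x. x \<in> A \<Longrightarrow> flow_cong E (p x) (q x)) \<Longrightarrow> flow_cong E (prod p A) (prod q A)"
  by (induction A rule: infinite_finite_induct)
    (auto intro: flow_cong_mult flow_cong_refl carrier_one)

section \<open>Reduction to basic monomials\<close>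

text \<open>The pair \<open>b\<close> may be \<open>(1, 1)\<close>, which gives the non-basic
  \<open>xp e * yp e\<close>: flow values are added among all four pairs before anything is
  reduced.\<close>

definition edge_monomial :: "'e \<Rightarrow> bit \<times> bit \<Rightarrow> 'e flow_poly" where
  "edge_monomial e b = xp e ^ of_bit (fst b) * yp e ^ of_bit (snd b)"

lemma basic_monomial_eq: "basic_monomial E \<psi> = (\<Prod>e\<in>E. edge_monomial e (\<psi> e))"
  by (simp add: basic_monomial_def edge_monomial_def)

lemma carrier_edge_monomial: "e \<in> E \<Longrightarrow> edge_monomial e b \<in> carrier (flow_poly_ring E)"
  unfolding edge_monomial_def by (intro carrier_intros)

lemma UNIV_bit_pair: "(UNIV :: (bit \<times> bit) set) = {(0, 0), (0, 1), (1, 0), (1, 1)}"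
proof -
  have "b \<in> {(0, 0), (0, 1), (1, 0), (1, 1)}" for b :: "bit \<times> bit"
    by (cases b; cases "fst b"; cases "snd b") auto
  then show ?thesis by auto
qed

lemma finite_bit_pair_set [simp]: "finite (B :: (bit \<times> bit) set)"
  by (rule finite_subset[OF subset_UNIV]) (simp add: UNIV_bit_pair)

text \<open>Adding bits differs from adding exponents only in 1 + 1 = 0, and there
  \<open>p\<^sup>2\<close> is congruent to 1.\<close>

lemma flow_cong_power_of_bit_add:
  assumes "flow_cong E (p\<^sup>2) 1" "p \<in> carrier (flow_poly_ring E)"
  shows "flow_cong E (p ^ of_bit a * p ^ of_bit b) (p ^ of_bit (a + b))"
  using assms
  by (cases a; cases b) (auto simp: power2_eq_square intro!: flow_cong_refl carrier_one)

lemma flow_cong_edge_monomial_add: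
  assumes "e \<in> E"
  shows "flow_cong E (edge_monomial e a * edge_monomial e b) (edge_monomial e (a + b))"
proof -
  have sq: "flow_cong E ((xp e)\<^sup>2) 1" "flow_cong E ((yp e)\<^sup>2) 1"
    using edge_relations_in_ideal[OF assms] assms
    by (auto simp: flow_cong_def intro!: carrier_intros)
  have "flow_cong E
     ((xp e ^ of_bit (fst a) * xp e ^ of_bit (fst b)) * (yp e ^ of_bit (snd a) * yp e ^ of_bit (snd b)))
     (xp e ^ of_bit (fst a + fst b) * yp e ^ of_bit (snd a + snd b))"
    by (intro flow_cong_mult flow_cong_power_of_bit_add sq carrier_Var assms)
  then show ?thesis
    by (simp add: edge_monomial_def mult_ac)
qed

text \<open>For basic \<open>b\<close>, the coefficient of the edge monomial of \<open>b\<close> in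
  the reduction of that of \<open>a\<close>. The constant -1 for \<open>a = (1, 1)\<close> comes
  from xy \<equiv> -1 - x - y.\<close>

definition reduction_coeff :: "bit \<times> bit \<Rightarrow> bit \<times> bit \<Rightarrow> int" where
  "reduction_coeff a b = (if a = (1, 1) then - 1 else if a = b then 1 else 0)"

lemma flow_cong_edge_monomial_reduce:
  assumes "e \<in> E"
  shows "flow_cong E (edge_monomial e a)
    (\<Sum>b\<in>{(0, 0), (0, 1), (1, 0)}. of_int (reduction_coeff a b) * edge_monomial e b)"
proof (cases "a = (1, 1)")
  case True
  have "edge_monomial e (1, 1) -
      (\<Sum>b\<in>{(0, 0), (0, 1), (1, 0)}. of_int (reduction_coeff (1, 1) b) * edge_monomial e b) =
      (xp e + 1) * (yp e + 1)"
    by (simp add: reduction_coeff_def edge_monomial_def algebra_simps)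
  moreover have "(\<Sum>b\<in>{(0, 0), (0, 1), (1, 0)}. of_int (reduction_coeff (1, 1) b) * edge_monomial e b)
      \<in> carrier (flow_poly_ring E)"
    using assms by (auto simp: reduction_coeff_def intro!: carrier_intros carrier_edge_monomial)
  ultimately show ?thesis
    using True assms by (simp add: flow_cong_def carrier_edge_monomial edge_relations_in_ideal)
next
  case False
  then have "a \<in> {(0, 0), (0, 1), (1, 0)}"
    using UNIV_bit_pair by blast
  then have "(\<Sum>b\<in>{(0, 0), (0, 1), (1, 0)}. of_int (reduction_coeff a b) * edge_monomial e b) =
      edge_monomial e a"
    using False by (auto simp: reduction_coeff_def)
  then show ?thesis
    using assms by (simp add: flow_cong_refl carrier_edge_monomial)
qed

lemma finite_basic_maps: "finite E \<Longrightarrow> finite (basic_maps E)"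
  by (simp add: basic_maps_def finite_PiE)

text \<open>Expanding the product of the edgewise reductions picks one basic exponent pair per edge,
  that is, a basic map.\<close>

lemma flow_cong_monomial_reduce:
  assumes "finite E"
  shows "flow_cong E (\<Prod>e\<in>E. edge_monomial e (\<phi> e))
    (\<Sum>\<psi>\<in>basic_maps E. of_int (\<Prod>e\<in>E. reduction_coeff (\<phi> e) (\<psi> e)) * basic_monomial E \<psi>)"
proof -
  have "flow_cong E (\<Prod>e\<in>E. edge_monomial e (\<phi> e))
    (\<Prod>e\<in>E. \<Sum>b\<in>{(0, 0), (0, 1), (1, 0)}. of_int (reduction_coeff (\<phi> e) b) * edge_monomial e b)"
    by (intro flow_cong_prod flow_cong_edge_monomial_reduce)
  then show ?thesis
    by (subst (asm) prod_sum_PiE)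
      (simp_all add: assms basic_maps_def basic_monomial_eq prod.distrib)
qed

subsection \<open>Uniqueness of normal forms\<close>

text \<open>The common zeros of the ideal are the maps from \<open>E\<close> to \<open>{(-1,-1), (-1,1), (1,-1)}\<close>; the value
  \<open>b\<close> of \<open>\<rho>\<close> at an edge encodes the zero \<open>((-1) ^ (1 - b\<^sub>1), (-1) ^ (1 - b\<^sub>2))\<close>.\<close>

definition sign_point :: "('e \<Rightarrow> bit \<times> bit) \<Rightarrow> 'e flow_var \<Rightarrow> complex" where
  "sign_point \<rho> z = (case z of XVar e \<Rightarrow> if fst (\<rho> e) = 1 then 1 else - 1
     | YVar e \<Rightarrow> if snd (\<rho> e) = 1 then 1 else - 1)"

text \<open>The kernel of evaluation is an ideal, so vanishing of the whole edge ideal at a point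
  need only be checked on generators.\<close>

lemma ideal_vanishing:
  "ideal {p \<in> carrier (flow_poly_ring E). poly_value s p = 0} (flow_poly_ring E)"
  (is "ideal ?I ?R")
proof (rule idealI)
  show "ring ?R" by (rule ring_flow_poly_ring)
  interpret cring ?R by (rule cring_flow_poly_ring)
  show "subgroup ?I (add_monoid ?R)"
  proof (rule add.subgroupI)
    fix p assume p: "p \<in> ?I"
    have "\<ominus>\<^bsub>?R\<^esub> p = - p"
    proof (rule minus_equality)
      show "- p \<oplus>\<^bsub>?R\<^esub> p = \<zero>\<^bsub>?R\<^esub>" by simp
    qed (use p carrier_uminus in auto)
    then show "\<ominus>\<^bsub>?R\<^esub> p \<in> ?I"
      using p carrier_uminus[of p E] poly_value_diff[of s 0 p] by simp
  next
    fix p q assume "p \<in> ?I" "q \<in> ?I"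
    then show "p \<oplus>\<^bsub>?R\<^esub> q \<in> ?I"
      using carrier_add[of p E q] by simp
  qed (use carrier_zero poly_value_zero in blast)+
  fix p q assume "p \<in> ?I" "q \<in> carrier ?R"
  then show "q \<otimes>\<^bsub>?R\<^esub> p \<in> ?I" "p \<otimes>\<^bsub>?R\<^esub> q \<in> ?I"
    using carrier_mult[of p E q] carrier_mult[of q E p] by simp_all
qed

lemma edge_ideal_vanishes:
  assumes "p \<in> edge_ideal E" "\<rho> \<in> basic_maps E"
  shows "poly_value (sign_point \<rho>) p = 0"
proof -
  have "edge_ideal E \<subseteq> {p \<in> carrier (flow_poly_ring E). poly_value (sign_point \<rho>) p = 0}"
    unfolding edge_ideal_def
  proof (rule ring.genideal_minimal[OF ring_flow_poly_ring ideal_vanishing], intro subsetI)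
    fix p assume p: "p \<in> (\<Union>e\<in>E. {(xp e)\<^sup>2 - 1, (yp e)\<^sup>2 - 1, (xp e + 1) * (yp e + 1)})"
    then obtain e where e: "e \<in> E" "p \<in> {(xp e)\<^sup>2 - 1, (yp e)\<^sup>2 - 1, (xp e + 1) * (yp e + 1)}"
      by blast
    \<comment> \<open>These codes stand for the sign pairs with at least one entry -1, where all
      three relations vanish.\<close>
    have "\<rho> e \<in> {(0, 0), (0, 1), (1, 0)}"
      using assms(2) e(1) by (auto simp: basic_maps_def)
    then have "poly_value (sign_point \<rho>) p = 0"
      using e(2) by (auto simp: sign_point_def)
    then show "p \<in> {p \<in> carrier (flow_poly_ring E). poly_value (sign_point \<rho>) p = 0}"
      using subsetD[OF edge_relations_subset_carrier p] by simp
  qed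
  then show ?thesis
    using assms(1) by blast
qed

definition edge_monomial_value :: "bit \<times> bit \<Rightarrow> bit \<times> bit \<Rightarrow> complex" where
  "edge_monomial_value r b =
    (if fst r = 1 then 1 else - 1) ^ of_bit (fst b) * (if snd r = 1 then 1 else - 1) ^ of_bit (snd b)"

lemma poly_value_basic_monomial:
  "poly_value (sign_point \<rho>) (basic_monomial E \<psi>) = (\<Prod>e\<in>E. edge_monomial_value (\<rho> e) (\<psi> e))"
  by (simp add: basic_monomial_def edge_monomial_value_def sign_point_def)

text \<open>The inverse of the \<open>3 \<times> 3\<close> matrix of values of \<open>1\<close>, \<open>y\<close>, \<open>x\<close> at the three zeros.\<close>

definition dual_weight :: "bit \<times> bit \<Rightarrow> bit \<times> bit \<Rightarrow> complex" where
  "dual_weight b r =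
    (if b = (0, 0) then (if r = (0, 0) then 0 else 1 / 2)
     else if r = b then 1 / 2 else if r = (0, 0) then - 1 / 2 else 0)"

lemma dual_weight_inverse:
  assumes "b \<in> {(0, 0), (0, 1), (1, 0)}" "b' \<in> {(0, 0), (0, 1), (1, 0)}"
  shows "(\<Sum>r\<in>{(0, 0), (0, 1), (1, 0)}. dual_weight b r * edge_monomial_value r b') = of_bool (b = b')"
  using assms by (auto simp: dual_weight_def edge_monomial_value_def)

text \<open>The matrix of values of basic monomials at the common zeros is a tensor power of the
  matrix for one edge, so products of edgewise inverses invert it and recover each
  coefficient.\<close>

lemma dual_weight_basic_combination:
  assumes "finite E" "\<psi> \<in> basic_maps E"
  shows "(\<Sum>\<rho>\<in>basic_maps E. (\<Prod>e\<in>E. dual_weight (\<psi> e) (\<rho> e)) *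
      poly_value (sign_point \<rho>) (\<Sum>\<psi>'\<in>basic_maps E. Const (a \<psi>') * basic_monomial E \<psi>')) = a \<psi>"
proof -
  have "(\<Sum>\<rho>\<in>basic_maps E. (\<Prod>e\<in>E. dual_weight (\<psi> e) (\<rho> e)) *
      (\<Prod>e\<in>E. edge_monomial_value (\<rho> e) (\<psi>' e))) = of_bool (\<psi>' = \<psi>)"
    if \<psi>': "\<psi>' \<in> basic_maps E" for \<psi>'
  proof -
    have "(\<Sum>\<rho>\<in>basic_maps E. (\<Prod>e\<in>E. dual_weight (\<psi> e) (\<rho> e)) *
      (\<Prod>e\<in>E. edge_monomial_value (\<rho> e) (\<psi>' e))) =
      (\<Prod>e\<in>E. \<Sum>r\<in>{(0, 0), (0, 1), (1, 0)}. dual_weight (\<psi> e) r * edge_monomial_value r (\<psi>' e))"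
      by (subst prod_sum_PiE) (simp_all add: assms basic_maps_def prod.distrib)
    also have "\<dots> = (\<Prod>e\<in>E. of_bool (\<psi> e = \<psi>' e))"
      using assms(2) \<psi>'
      by (intro prod.cong refl dual_weight_inverse) (auto simp: basic_maps_def)
    also have "\<dots> = of_bool (\<psi>' = \<psi>)"
    proof (cases "\<psi>' = \<psi>")
      case False
      \<comment> \<open>Both maps are extensional, so they differ at an edge of \<open>E\<close>,
        and that edge contributes a factor 0.\<close>
      then obtain e where "e \<in> E" "\<psi> e \<noteq> \<psi>' e"
        using PiE_ext[of \<psi> E _ \<psi>'] assms(2) \<psi>' unfolding basic_maps_def by metis
      then show ?thesis
        using assms(1) False by (auto intro!: prod_zero)
    qed simp
    finally show ?thesis .
  qed
  note orth = this
  have "(\<Sum>\<rho>\<in>basic_maps E. (\<Prod>e\<in>E. dual_weight (\<psi> e) (\<rho> e)) *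
      poly_value (sign_point \<rho>) (\<Sum>\<psi>'\<in>basic_maps E. Const (a \<psi>') * basic_monomial E \<psi>')) =
    (\<Sum>\<rho>\<in>basic_maps E. \<Sum>\<psi>'\<in>basic_maps E. a \<psi>' * ((\<Prod>e\<in>E. dual_weight (\<psi> e) (\<rho> e)) *
      (\<Prod>e\<in>E. edge_monomial_value (\<rho> e) (\<psi>' e))))"
    by (simp add: poly_value_basic_monomial sum_distrib_left mult_ac)
  also have "\<dots> = (\<Sum>\<psi>'\<in>basic_maps E. a \<psi>' * (\<Sum>\<rho>\<in>basic_maps E. ((\<Prod>e\<in>E. dual_weight (\<psi> e) (\<rho> e)) *
      (\<Prod>e\<in>E. edge_monomial_value (\<rho> e) (\<psi>' e)))))"
    by (subst sum.swap) (simp add: sum_distrib_left)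
  also have "\<dots> = (\<Sum>\<psi>'\<in>basic_maps E. a \<psi>' * of_bool (\<psi>' = \<psi>))"
    by (intro sum.cong refl arg_cong2[where f = "(*)"] orth)
  also have "\<dots> = a \<psi>"
    using assms by (simp add: finite_basic_maps)
  finally show ?thesis .
qed

text \<open>Two candidates differ by an element of the ideal, hence agree at all common zeros, hence
  have equal coefficients.\<close>

lemma normal_form_eqI:
  assumes "finite E" "g \<in> basic_combinations E" "f - g \<in> edge_ideal E"
  shows "normal_form E f = g"
  unfolding normal_form_def
proof (rule the_equality)
  fix g' assume g': "g' \<in> basic_combinations E \<and> f - g' \<in> edge_ideal E"
  obtain a where a: "g = (\<Sum>\<psi>\<in>basic_maps E. Const (a \<psi>) * basic_monomial E \<psi>)"
    using assms(2) by (auto simp: basic_combinations_def)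
  obtain b where b: "g' = (\<Sum>\<psi>\<in>basic_maps E. Const (b \<psi>) * basic_monomial E \<psi>)"
    using g' by (auto simp: basic_combinations_def)
  have "poly_value (sign_point \<rho>) g' = poly_value (sign_point \<rho>) g" if "\<rho> \<in> basic_maps E" for \<rho>
    using edge_ideal_vanishes[OF assms(3) that] edge_ideal_vanishes[OF conjunct2[OF g'] that] by simp
  then have "b \<psi> = a \<psi>" if "\<psi> \<in> basic_maps E" for \<psi>
    using dual_weight_basic_combination[OF assms(1) that, of a]
      dual_weight_basic_combination[OF assms(1) that, of b]
    unfolding a[symmetric] b[symmetric] by simp
  then show "g' = g"
    unfolding a b by (intro sum.cong refl) simp
qed (use assms in blast)

subsection \<open>Potentials of dual four-flows\<close>

lemma bit_pair_add_self [simp]: "b + b = 0" for b :: "bit \<times> bit"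
  by (cases b; cases "fst b"; cases "snd b") (auto simp: zero_prod_def)

lemma bit_pair_add_self_left [simp]: "a + (a + b) = b" for a b :: "bit \<times> bit"
  by (simp flip: add.assoc)

text \<open>The group has exponent 2, so the difference of the potential at the two ends is their
  sum and no orientation is chosen.\<close>

definition coboundary :: "('e \<Rightarrow> 'v set) \<Rightarrow> ('v \<Rightarrow> bit \<times> bit) \<Rightarrow> 'e \<Rightarrow> bit \<times> bit" where
  "coboundary ends h e = (\<Sum>v\<in>ends e. h v)"

section \<open>Simple paths\<close>

definition simple_path :: "'e set \<Rightarrow> ('e \<Rightarrow> 'v set) \<Rightarrow> 'v list \<Rightarrow> 'e list \<Rightarrow> bool" where
  "simple_path E ends vs es \<longleftrightarrow> length vs = Suc (length es) \<and> distinct vs \<and> set es \<subseteq> E \<and>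
     (\<forall>i < length es. ends (es ! i) = {vs ! i, vs ! Suc i})"

lemma simple_path_distinct_edges:
  assumes "simple_path E ends vs es"
  shows "distinct es"
  unfolding distinct_conv_nth
proof (intro allI impI)
  fix i j assume ij: "i < length es" "j < length es" "i \<noteq> j"
  have vs: "length vs = Suc (length es)" "distinct vs"
    using assms by (auto simp: simple_path_def)
  show "es ! i \<noteq> es ! j"
  proof
    assume "es ! i = es ! j"
    then have "{vs ! i, vs ! Suc i} = {vs ! j, vs ! Suc j}"
      using assms ij unfolding simple_path_def by metis
    \<comment> \<open>By distinctness of the vertices, the first case forces i = j and the second
      forces i = j + 1 and i + 1 = j.\<close>
    then have "vs ! i = vs ! j \<or> vs ! i = vs ! Suc j \<and> vs ! Suc i = vs ! j"
      by (auto simp: doubleton_eq_iff)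
    then show False
      using ij vs by (auto simp: nth_eq_iff_index_eq)
  qed
qed

text \<open>Loop erasure: a walk is extended edge by edge, and on returning to a vertex of the path
  the path is cut back to that vertex.\<close>

lemma simple_path_exists:
  assumes "(u, v) \<in> (adjacency E ends)\<^sup>*"
  shows "\<exists>vs es. simple_path E ends vs es \<and> vs ! 0 = u \<and> vs ! length es = v"
  using assms
proof (induction rule: rtrancl_induct)
  case base
  have "simple_path E ends [u] []"
    by (simp add: simple_path_def)
  then show ?case
    by (metis list.size(3) nth_Cons_0)
next
  case (step v w)
  then obtain vs es where path: "simple_path E ends vs es" "vs ! 0 = u" "vs ! length es = v"
    by blast
  obtain e where e: "e \<in> E" "ends e = {v, w}"
    using step by (auto simp: adjacency_def)
  show ?case
  proof (cases "w \<in> set vs")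
    case True
    then obtain k where k: "k < length vs" "vs ! k = w"
      by (auto simp: in_set_conv_nth)
    have "simple_path E ends (take (Suc k) vs) (take k es)"
      using path(1) k set_take_subset[of k es] by (auto simp: simple_path_def)
    moreover have "take (Suc k) vs ! 0 = u" "take (Suc k) vs ! length (take k es) = w"
      using path k by (auto simp: simple_path_def)
    ultimately show ?thesis by blast
  next
    case False
    have "simple_path E ends (vs @ [w]) (es @ [e])"
      using path e False by (auto simp: simple_path_def nth_append less_Suc_eq)
    moreover have "(vs @ [w]) ! 0 = u" "(vs @ [w]) ! length (es @ [e]) = w"
      using path by (auto simp: simple_path_def nth_append)
    ultimately show ?thesis by blast
  qed
qed

lemma sum_set_distinct: "distinct es \<Longrightarrow> (\<Sum>e\<in>set es. f e) = (\<Sum>i<length es. f (es ! i))"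
  by (simp add: sum_list_distinct_conv_sum_set[symmetric] sum_list_sum_nth atLeast0LessThan)

text \<open>Every inner value occurs twice and cancels in exponent 2.\<close>

lemma bit_pair_telescope:
  fixes g :: "nat \<Rightarrow> bit \<times> bit"
  shows "(\<Sum>i<n. g i + g (Suc i)) = g 0 + g n"
proof (induction n)
  case (Suc n)
  have "g 0 + g n + (g n + g (Suc n)) = g 0 + (g n + (g n + g (Suc n)))"
    by (simp only: add.assoc)
  then show ?case using Suc by simp
qed simp

context finite_graph
begin

lemma coboundary_ends: "e \<in> E \<Longrightarrow> ends e = {u, v} \<Longrightarrow> coboundary ends h e = h u + h v"
  using card_ends[of e] by (cases "u = v") (simp_all add: coboundary_def)

lemma coboundary_circuit:
  assumes "is_circuit E ends C"
  shows "(\<Sum>e\<in>C. coboundary ends h e) = 0"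
proof -
  obtain vs es where c: "length vs = length es" "2 \<le> length es" "distinct es" "C = set es" "C \<subseteq> E"
    "\<And>i. i < length es \<Longrightarrow> ends (es ! i) = {vs ! i, vs ! (Suc i mod length es)}"
    using assms by (auto simp: is_circuit_def)
  \<comment> \<open>The index is reduced modulo the length so that the last edge returns to the
    first vertex; the two boundary terms of the telescope then coincide and cancel.\<close>
  let ?g = "\<lambda>i. h (vs ! (i mod length es))"
  have "(\<Sum>e\<in>C. coboundary ends h e) = (\<Sum>i<length es. coboundary ends h (es ! i))"
    using c by (simp add: sum_set_distinct)
  also have "\<dots> = (\<Sum>i<length es. ?g i + ?g (Suc i))"
  proof (rule sum.cong)
    fix i assume "i \<in> {..<length es}"
    then have "i < length es" by simp
    moreover from this have "es ! i \<in> E" using c by auto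
    ultimately show "coboundary ends h (es ! i) = ?g i + ?g (Suc i)"
      using coboundary_ends[OF _ c(6)] by simp
  qed simp
  also have "\<dots> = ?g 0 + ?g (length es)"
    by (rule bit_pair_telescope)
  finally show ?thesis by simp
qed

text \<open>Edges are added one at a time: an edge inside a component closes a circuit, which forces its
  value; for an edge joining two components, the potential is shifted on one of them.\<close>

lemma potential_exists:
  assumes flow: "\<And>C. is_circuit E ends C \<Longrightarrow> (\<Sum>e\<in>C. \<phi> e) = 0" and "F \<subseteq> E"
  shows "\<exists>h. \<forall>e\<in>F. coboundary ends h e = \<phi> e"
  using finite_subset[OF \<open>F \<subseteq> E\<close> finite_E] \<open>F \<subseteq> E\<close>
proof (induction F rule: finite_induct)
  case (insert e F)
  then obtain h where h: "\<forall>e\<in>F. coboundary ends h e = \<phi> e"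
    by blast
  have e: "e \<in> E" and F: "F \<subseteq> E" using insert by auto
  obtain u v where uv: "ends e = {u, v}" "u \<noteq> v"
    using card_ends[OF e] by (auto simp: card_2_iff)
  have sym: "sym ((adjacency F ends)\<^sup>*)"
    by (intro sym_rtrancl symI) (auto simp: adjacency_def insert_commute)
  show ?case
  proof (cases "(u, v) \<in> (adjacency F ends)\<^sup>*")
    case True
    then obtain vs es where path: "simple_path F ends vs es" "vs ! 0 = u" "vs ! length es = v"
      using simple_path_exists by meson
    have len: "length vs = Suc (length es)"
      and nth: "\<And>i. i < length es \<Longrightarrow> ends (es ! i) = {vs ! i, vs ! Suc i}"
      and es: "set es \<subseteq> F" and dvs: "distinct vs"
      using path by (auto simp: simple_path_def)
    have des: "distinct es"
      using path(1) by (rule simple_path_distinct_edges)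
    \<comment> \<open>As \<open>u\<close> and \<open>v\<close> differ, the path is not empty, so
      adding \<open>e\<close> gives at least two edges.\<close>
    have "1 \<le> length es"
      using path uv by (cases es) auto
    moreover have "Suc i mod Suc (length es) = Suc i" if "i < length es" for i
      using that by simp
    \<comment> \<open>The index wraps around only at the last position, where \<open>e\<close> leads
      from \<open>v\<close> back to \<open>u\<close>; \<open>e\<close> is new because the path lies
      in \<open>F\<close>.\<close>
    ultimately have "is_circuit E ends (set (es @ [e]))"
      unfolding is_circuit_def
      using len nth es dvs des insert.hyps(2) e F path uv
      by (intro exI[of _ vs] exI[of _ "es @ [e]"]) (auto simp: nth_append less_Suc_eq)
    then have "(\<Sum>e'\<in>set (es @ [e]). \<phi> e') = 0"
      by (rule flow)
    moreover have "e \<notin> set es"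
      using es insert.hyps(2) by blast
    ultimately have "\<phi> e + (\<Sum>e'\<in>set es. \<phi> e') = 0"
      by simp
    also have "(\<Sum>e'\<in>set es. \<phi> e') = (\<Sum>i<length es. \<phi> (es ! i))"
      using des by (rule sum_set_distinct)
    also have "\<dots> = (\<Sum>i<length es. h (vs ! i) + h (vs ! Suc i))"
    proof (rule sum.cong)
      fix i assume "i \<in> {..<length es}"
      then have i: "i < length es" by simp
      then have "es ! i \<in> F" using es by auto
      then have "\<phi> (es ! i) = coboundary ends h (es ! i)" "es ! i \<in> E"
        using h F by auto
      then show "\<phi> (es ! i) = h (vs ! i) + h (vs ! Suc i)"
        using coboundary_ends nth[OF i] by metis
    qed simp
    also have "\<dots> = h u + h v"
      using bit_pair_telescope[of "\<lambda>i. h (vs ! i)"] path by simp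
    finally have "\<phi> e = h u + h v"
      by (metis add.right_neutral add.assoc bit_pair_add_self)
    then have "coboundary ends h e = \<phi> e"
      using coboundary_ends[OF e uv(1)] by simp
    then show ?thesis
      using h by blast
  next
    case False
    define K where "K = {w. (v, w) \<in> (adjacency F ends)\<^sup>*}"
    \<comment> \<open>The shift is the amount by which \<open>h\<close> misses the value at
      \<open>e\<close>. Only \<open>v\<close> lies in \<open>K\<close>, so \<open>e\<close> is
      corrected, while an edge of \<open>F\<close> has both ends or neither in \<open>K\<close> and
      keeps its value.\<close>
    define h' where "h' w = h w + (if w \<in> K then \<phi> e + (h u + h v) else 0)" for w
    have "v \<in> K" "u \<notin> K"
      using False symD[OF sym] by (auto simp: K_def)
    then have "h' u + h' v = \<phi> e"
      by (simp add: h'_def add_ac)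
    then have "coboundary ends h' e = \<phi> e"
      using coboundary_ends[OF e uv(1)] by simp
    moreover have "coboundary ends h' e' = \<phi> e'" if "e' \<in> F" for e'
    proof -
      have e': "e' \<in> E" using that F by blast
      obtain a b where ab: "ends e' = {a, b}"
        using card_ends[OF e'] by (auto simp: card_2_iff)
      then have "(a, b) \<in> adjacency F ends" "(b, a) \<in> adjacency F ends"
        using that by (auto simp: adjacency_def)
      then have "a \<in> K \<longleftrightarrow> b \<in> K"
        unfolding K_def by (auto intro: rtrancl_into_rtrancl)
      then have "h' a + h' b = h a + h b"
        by (simp add: h'_def add_ac)
      then show ?thesis
        using coboundary_ends[OF e' ab] h that by metis
    qed
    ultimately show ?thesis by blast
  qed
qed simp

section \<open>Counting the potentials of a flow\<close>

abbreviation reach :: "('v \<times> 'v) set" where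
  "reach \<equiv> (adjacency E ends)\<^sup>* \<inter> V \<times> V"

lemma equiv_reach: "equiv V reach"
proof -
  have "sym ((adjacency E ends)\<^sup>*)"
    by (intro sym_rtrancl symI) (auto simp: adjacency_def insert_commute)
  then show ?thesis
    by (auto intro!: equivI refl_onI symI transI dest: symD intro: rtrancl_trans)
qed

text \<open>Extensionality on \<open>V\<close> makes these finitely many, one for each function on
  the vertices.\<close>

definition potentials :: "('e \<Rightarrow> bit \<times> bit) \<Rightarrow> ('v \<Rightarrow> bit \<times> bit) set" where
  "potentials \<phi> = {h \<in> V \<rightarrow>\<^sub>E UNIV. \<forall>e\<in>E. coboundary ends h e = \<phi> e}"

lemma coboundary_zero_const:
  assumes "\<forall>e\<in>E. coboundary ends h e = 0" "(u, v) \<in> (adjacency E ends)\<^sup>*"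
  shows "h u = h v"
  using assms(2)
proof (induction rule: rtrancl_induct)
  case (step v w)
  then obtain e where "e \<in> E" "ends e = {v, w}"
    by (auto simp: adjacency_def)
  then have "h v + h w = 0"
    using assms(1) coboundary_ends by metis
  then have "h v = h w"
    by (metis add.right_neutral bit_pair_add_self_left)
  with step show ?case by simp
qed simp

lemma coboundary_restrict: "e \<in> E \<Longrightarrow> coboundary ends (restrict h V) e = coboundary ends h e"
  unfolding coboundary_def using ends_subset by (intro sum.cong) auto

lemma coboundary_add: "coboundary ends (\<lambda>v. g v + h v) e = coboundary ends g e + coboundary ends h e"
  by (simp add: coboundary_def sum.distrib)

text \<open>Once one potential \<open>h\<close> is fixed, the others arise from it by adding a
  function constant on components, with four choices on each.\<close>

lemma card_potentials:
  assumes flow: "\<phi> \<in> dual_four_flows E ends"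
  shows "card (potentials \<phi>) = 4 ^ num_components V E ends"
proof -
  have "\<And>C. is_circuit E ends C \<Longrightarrow> (\<Sum>e\<in>C. \<phi> e) = 0"
    using flow by (simp add: dual_four_flows_def zero_prod_def)
  then obtain h where h: "\<forall>e\<in>E. coboundary ends h e = \<phi> e"
    using potential_exists by blast
  define Q where "Q = connected_components V E ends"
  have Q: "Q = V // reach"
    by (simp add: Q_def connected_components_def)
  \<comment> \<open>\<open>S k\<close> shifts \<open>h\<close> on each component by the value that
    \<open>k\<close> assigns to it.\<close>
  define S where "S k = (\<lambda>v\<in>V. h v + k (reach `` {v}))" for k :: "'v set \<Rightarrow> bit \<times> bit"
  have "bij_betw S (Q \<rightarrow>\<^sub>E UNIV) (potentials \<phi>)"
  proof (rule bij_betwI')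
    fix k l :: "'v set \<Rightarrow> bit \<times> bit"
    assume kl: "k \<in> Q \<rightarrow>\<^sub>E UNIV" "l \<in> Q \<rightarrow>\<^sub>E UNIV"
    show "(S k = S l) = (k = l)"
    proof
      assume eq: "S k = S l"
      show "k = l"
      proof (rule PiE_ext[OF kl])
        fix A assume "A \<in> Q"
        then obtain v where "v \<in> V" "A = reach `` {v}"
          unfolding Q by (auto elim: quotientE)
        then show "k A = l A"
          using fun_cong[OF eq, of v] by (simp add: S_def)
      qed
    qed simp
  next
    fix k assume "k \<in> Q \<rightarrow>\<^sub>E (UNIV :: (bit \<times> bit) set)"
    have "coboundary ends (S k) e = \<phi> e" if e: "e \<in> E" for e
    proof -
      obtain a b where ab: "ends e = {a, b}"
        using card_ends[OF e] by (auto simp: card_2_iff)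
      then have "(a, b) \<in> reach"
        using e ends_subset[OF e] by (auto simp: adjacency_def)
      then have "reach `` {a} = reach `` {b}"
        by (rule equiv_class_eq[OF equiv_reach])
      then have "coboundary ends (\<lambda>v. k (reach `` {v})) e = 0"
        using coboundary_ends[OF e ab] by simp
      then show ?thesis
        using h e by (simp add: S_def coboundary_restrict coboundary_add)
    qed
    then show "S k \<in> potentials \<phi>"
      by (auto simp: potentials_def S_def)
  next
    fix g assume g: "g \<in> potentials \<phi>"
    let ?d = "\<lambda>v. h v + g v"
    have d: "\<forall>e\<in>E. coboundary ends ?d e = 0"
      using g h by (simp add: coboundary_add potentials_def)
    \<comment> \<open>Since \<open>?d\<close> is constant on components, any representative gives
      the same value. The sum \<open>h v + g v\<close> serves as the difference, so adding it to
      \<open>h v\<close> returns \<open>g v\<close>.\<close>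
    define k where "k = (\<lambda>A\<in>Q. ?d (SOME v. v \<in> A))"
    have "S k = g"
    proof (rule PiE_ext[where k = V and s = "\<lambda>_. UNIV"])
      fix v assume v: "v \<in> V"
      let ?A = "reach `` {v}"
      have "v \<in> ?A" using v by simp
      then have "(SOME w. w \<in> ?A) \<in> ?A" by (rule someI)
      then have "?d v = ?d (SOME w. w \<in> ?A)"
        using coboundary_zero_const[OF d] by blast
      moreover have "?A \<in> Q"
        unfolding Q using v by (rule quotientI)
      ultimately have "k ?A = h v + g v"
        unfolding k_def by (simp only: restrict_apply')
      then show "S k v = g v"
        using v by (simp add: S_def)
    qed (use g in \<open>auto simp: S_def potentials_def\<close>)
    moreover have "k \<in> Q \<rightarrow>\<^sub>E UNIV"
      by (simp add: k_def)
    ultimately show "\<exists>k\<in>Q \<rightarrow>\<^sub>E UNIV. g = S k"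
      by blast
  qed
  then have "card (potentials \<phi>) = card (Q \<rightarrow>\<^sub>E (UNIV :: (bit \<times> bit) set))"
    by (simp add: bij_betw_same_card)
  moreover have "finite Q"
    unfolding Q using finite_V by (rule finite_quotient) auto
  moreover have "card (UNIV :: (bit \<times> bit) set) = 4"
    by (simp add: UNIV_bit_pair)
  ultimately show ?thesis
    by (simp add: card_funcsetE Q_def num_components_def)
qed

end

subsection \<open>The four-flow polynomial\<close>

text \<open>Taking 1 or the product in each of the two factors gives four terms; the choice made at
  a vertex becomes the value of the potential there.\<close>

lemma vertex_factor_expand:
  "((\<Prod>e\<in>D. xp e) + 1) * ((\<Prod>e\<in>D. yp e) + 1) = (\<Sum>b\<in>UNIV. \<Prod>e\<in>D. edge_monomial e b)"
  by (simp add: UNIV_bit_pair edge_monomial_def prod.distrib algebra_simps)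

lemma flow_cong_edge_monomial_sum:
  assumes "e \<in> E" "finite A"
  shows "flow_cong E (\<Prod>v\<in>A. edge_monomial e (h v)) (edge_monomial e (\<Sum>v\<in>A. h v))"
  using assms(2)
proof (induction A rule: finite_induct)
  case empty
  have "edge_monomial e 0 = 1"
    by (simp add: edge_monomial_def)
  then show ?case
    by (simp add: flow_cong_refl carrier_one)
next
  case (insert v A)
  have "flow_cong E (edge_monomial e (h v) * (\<Prod>v\<in>A. edge_monomial e (h v)))
      (edge_monomial e (h v) * edge_monomial e (\<Sum>v\<in>A. h v))"
    by (intro flow_cong_mult flow_cong_refl carrier_edge_monomial assms insert.IH)
  then show ?case
    using flow_cong_trans[OF _ flow_cong_edge_monomial_add[OF assms(1)]] insert.hyps by simp
qed

section \<open>Signs of flows and their signed count\<close>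

text \<open>For a conformal map each edge with value \<open>(1, 1)\<close> contributes -1 and every
  other edge 1; a failure of conformality produces a factor 0.\<close>

lemma prod_reduction_coeff:
  assumes "finite E" "\<psi> \<in> basic_maps E"
  shows "(\<Prod>e\<in>E. reduction_coeff (\<phi> e) (\<psi> e)) =
    (if conformal E \<psi> \<phi> then if even_map E \<phi> then 1 else - 1 else 0)"
proof (cases "conformal E \<psi> \<phi>")
  case True
  then have "(\<Prod>e\<in>E. reduction_coeff (\<phi> e) (\<psi> e)) = (\<Prod>e\<in>E. if \<phi> e = (1, 1) then - 1 else 1)"
    by (intro prod.cong) (auto simp: conformal_def reduction_coeff_def)
  also have "\<dots> = (- 1) ^ card {e \<in> E. \<phi> e = (1, 1)}"
    by (simp add: assms(1) flip: prod.inter_filter)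
  finally show ?thesis
    using True by (simp add: even_map_def)
next
  case False
  then obtain e where "e \<in> E" "reduction_coeff (\<phi> e) (\<psi> e) = 0"
    by (auto simp: conformal_def reduction_coeff_def)
  then show ?thesis
    using False assms(1) by (auto intro!: prod_zero)
qed

lemma finite_dual_four_flows: "finite E \<Longrightarrow> finite (dual_four_flows E ends)"
  by (rule finite_subset[of _ "E \<rightarrow>\<^sub>E UNIV"]) (auto simp: dual_four_flows_def intro!: finite_PiE)

lemma sum_reduction_coeff:
  assumes "finite E" "\<psi> \<in> basic_maps E"
  shows "(\<Sum>\<phi>\<in>dual_four_flows E ends. \<Prod>e\<in>E. reduction_coeff (\<phi> e) (\<psi> e)) = flow_coeff E ends \<psi>"
proof -
  let ?D = "dual_four_flows E ends"
  have "(\<Sum>\<phi>\<in>?D. \<Prod>e\<in>E. reduction_coeff (\<phi> e) (\<psi> e)) =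
    (\<Sum>\<phi>\<in>?D. of_bool (conformal E \<psi> \<phi> \<and> even_map E \<phi>) - of_bool (conformal E \<psi> \<phi> \<and> \<not> even_map E \<phi>))"
    by (intro sum.cong) (simp_all add: prod_reduction_coeff assms)
  then show ?thesis
    using finite_dual_four_flows[OF assms(1), of ends]
    by (simp add: sum_subtractf flow_coeff_def of_bool_def sum.If_cases Int_def)
qed

context finite_graph
begin

lemma four_flow_poly_expand:
  "four_flow_poly V E ends = (\<Sum>h\<in>V \<rightarrow>\<^sub>E UNIV. \<Prod>e\<in>E. \<Prod>v\<in>ends e. edge_monomial e (h v))"
proof -
  have "four_flow_poly V E ends =
      (\<Sum>h\<in>V \<rightarrow>\<^sub>E UNIV. \<Prod>v\<in>V. \<Prod>e\<in>incident_edges E ends v. edge_monomial e (h v))"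
    unfolding four_flow_poly_def vertex_factor_expand
    by (rule prod_sum_PiE) (simp_all add: finite_V)
  also have "\<dots> = (\<Sum>h\<in>V \<rightarrow>\<^sub>E UNIV. \<Prod>e\<in>E. \<Prod>v\<in>ends e. edge_monomial e (h v))"
  proof (rule sum.cong)
    fix h :: "'v \<Rightarrow> bit \<times> bit"
    have "(\<Prod>v\<in>V. \<Prod>e\<in>incident_edges E ends v. edge_monomial e (h v)) =
        (\<Prod>e\<in>E. \<Prod>v\<in>{v \<in> V. v \<in> ends e}. edge_monomial e (h v))"
      \<comment> \<open>Incident pairs are regrouped by edge instead of by vertex.\<close>
      unfolding incident_edges_def by (rule prod.swap_restrict[OF finite_V finite_E])
    also have "\<dots> = (\<Prod>e\<in>E. \<Prod>v\<in>ends e. edge_monomial e (h v))"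
      using ends_subset by (intro prod.cong) auto
    finally show "(\<Prod>v\<in>V. \<Prod>e\<in>incident_edges E ends v. edge_monomial e (h v)) =
        (\<Prod>e\<in>E. \<Prod>v\<in>ends e. edge_monomial e (h v))" .
  qed simp
  finally show ?thesis .
qed

lemma coboundary_dual_four_flow: "restrict (coboundary ends h) E \<in> dual_four_flows E ends"
proof -
  have "(\<Sum>e\<in>C. restrict (coboundary ends h) E e) = (0, 0)" if "is_circuit E ends C" for C
  proof -
    have "C \<subseteq> E" using that by (auto simp: is_circuit_def)
    then have "(\<Sum>e\<in>C. restrict (coboundary ends h) E e) = (\<Sum>e\<in>C. coboundary ends h e)"
      by (intro sum.cong) auto
    then show ?thesis
      using coboundary_circuit[OF that] by (simp add: zero_prod_def)
  qed
  then show ?thesis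
    by (simp add: dual_four_flows_def)
qed

text \<open>The sum is grouped by the fibres of the coboundary map; the fibre over each dual
  four-flow is its set of potentials, of size \<open>4 ^ num_components V E ends\<close>.\<close>

lemma sum_coboundary:
  fixes F :: "('e \<Rightarrow> bit \<times> bit) \<Rightarrow> 'a :: comm_ring_1"
  shows "(\<Sum>h\<in>V \<rightarrow>\<^sub>E UNIV. F (restrict (coboundary ends h) E)) =
    4 ^ num_components V E ends * (\<Sum>\<phi>\<in>dual_four_flows E ends. F \<phi>)"
proof -
  let ?P = "V \<rightarrow>\<^sub>E (UNIV :: (bit \<times> bit) set)" and ?c = "\<lambda>h. restrict (coboundary ends h) E"
  have "(\<Sum>h\<in>?P. F (?c h)) = (\<Sum>\<phi>\<in>dual_four_flows E ends. \<Sum>h\<in>{h \<in> ?P. ?c h = \<phi>}. F (?c h))"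
    by (rule sum.group[symmetric])
      (auto simp: finite_V finite_E finite_dual_four_flows coboundary_dual_four_flow intro!: finite_PiE)
  also have "\<dots> = (\<Sum>\<phi>\<in>dual_four_flows E ends. 4 ^ num_components V E ends * F \<phi>)"
  proof (rule sum.cong)
    fix \<phi> assume \<phi>: "\<phi> \<in> dual_four_flows E ends"
    then have "\<phi> \<in> extensional E"
      by (auto simp: dual_four_flows_def PiE_def)
    \<comment> \<open>Outside \<open>E\<close> both maps take the default value
      \<open>undefined\<close>, so equality is decided on \<open>E\<close>.\<close>
    then have "?c h = \<phi> \<longleftrightarrow> (\<forall>e\<in>E. coboundary ends h e = \<phi> e)" for h
      by (auto simp: fun_eq_iff restrict_def extensional_def)
    then have "{h \<in> ?P. ?c h = \<phi>} = potentials \<phi>"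
      by (auto simp: potentials_def)
    moreover have "(\<Sum>h\<in>{h \<in> ?P. ?c h = \<phi>}. F (?c h)) = (\<Sum>h\<in>{h \<in> ?P. ?c h = \<phi>}. F \<phi>)"
      by (intro sum.cong) auto
    ultimately show "(\<Sum>h\<in>{h \<in> ?P. ?c h = \<phi>}. F (?c h)) = 4 ^ num_components V E ends * F \<phi>"
      using card_potentials[OF \<phi>] by simp
  qed simp
  finally show ?thesis
    by (simp add: sum_distrib_left)
qed

lemma flow_cong_four_flow_poly:
  "flow_cong E (four_flow_poly V E ends)
    (4 ^ num_components V E ends *
      (\<Sum>\<psi>\<in>basic_maps E. of_int (flow_coeff E ends \<psi>) * basic_monomial E \<psi>))"
proof -
  let ?D = "dual_four_flows E ends" and ?k = "4 ^ num_components V E ends :: 'e flow_poly"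
  have fin: "finite (ends e)" if "e \<in> E" for e
    using ends_subset[OF that] finite_V by (rule finite_subset)
  have "flow_cong E (four_flow_poly V E ends)
      (\<Sum>h\<in>V \<rightarrow>\<^sub>E UNIV. \<Prod>e\<in>E. edge_monomial e (\<Sum>v\<in>ends e. h v))"
    unfolding four_flow_poly_expand
    by (intro flow_cong_sum flow_cong_prod flow_cong_edge_monomial_sum fin)
  also have "(\<Sum>h\<in>V \<rightarrow>\<^sub>E UNIV. \<Prod>e\<in>E. edge_monomial e (\<Sum>v\<in>ends e. h v)) =
      (\<Sum>h\<in>V \<rightarrow>\<^sub>E UNIV. \<Prod>e\<in>E. edge_monomial e (restrict (coboundary ends h) E e))"
    by (simp add: coboundary_def)
  also have "\<dots> = ?k * (\<Sum>\<phi>\<in>?D. \<Prod>e\<in>E. edge_monomial e (\<phi> e))"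
    by (rule sum_coboundary)
  finally have 1: "flow_cong E (four_flow_poly V E ends) \<dots>" .
  have "(4 :: 'e flow_poly) = Const 4"
    by (simp add: Const_def)
  then have "?k \<in> carrier (flow_poly_ring E)"
    by (metis carrier_Const carrier_power)
  then have 2: "flow_cong E (?k * (\<Sum>\<phi>\<in>?D. \<Prod>e\<in>E. edge_monomial e (\<phi> e)))
      (?k * (\<Sum>\<phi>\<in>?D. \<Sum>\<psi>\<in>basic_maps E.
        of_int (\<Prod>e\<in>E. reduction_coeff (\<phi> e) (\<psi> e)) * basic_monomial E \<psi>))"
    by (intro flow_cong_mult flow_cong_refl flow_cong_sum flow_cong_monomial_reduce finite_E)
  have "(\<Sum>\<phi>\<in>?D. \<Sum>\<psi>\<in>basic_maps E.
        of_int (\<Prod>e\<in>E. reduction_coeff (\<phi> e) (\<psi> e)) * basic_monomial E \<psi>) =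
      (\<Sum>\<psi>\<in>basic_maps E. of_int (\<Sum>\<phi>\<in>?D. \<Prod>e\<in>E. reduction_coeff (\<phi> e) (\<psi> e)) * basic_monomial E \<psi>)"
    \<comment> \<open>Exchanging the sums collects, for each basic map, the signs of all flows
      conformal to it.\<close>
    by (subst sum.swap) (simp add: sum_distrib_right)
  also have "\<dots> = (\<Sum>\<psi>\<in>basic_maps E. of_int (flow_coeff E ends \<psi>) * basic_monomial E \<psi>)"
    by (intro sum.cong refl) (simp only: sum_reduction_coeff[OF finite_E])
  finally show ?thesis
    using flow_cong_trans[OF 1 2] by simp
qed

end

theorem theorem4p6:
  fixes V :: "'v set" and E :: "'e set" and ends :: "'e \<Rightarrow> 'v set"
  assumes "finite_graph V E ends"
  shows "normal_form E (four_flow_poly V E ends) =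
    4 ^ num_components V E ends *
      (\<Sum>\<psi>\<in>basic_maps E. of_int (flow_coeff E ends \<psi>) * basic_monomial E \<psi>)"
    (is "_ = ?g")
proof (rule normal_form_eqI)
  show "finite E"
    using assms by (rule finite_graph.finite_E)
  \<comment> \<open>Basic combinations have complex constants as coefficients, so the power of 4 and
    the signed count are merged into one constant.\<close>
  let ?a = "\<lambda>\<psi>. of_int (4 ^ num_components V E ends * flow_coeff E ends \<psi>) :: complex"
  have "?g = (\<Sum>\<psi>\<in>basic_maps E. Const (?a \<psi>) * basic_monomial E \<psi>)"
    unfolding Const_def single_of_int by (simp add: sum_distrib_left mult.assoc)
  then show "?g \<in> basic_combinations E"
    unfolding basic_combinations_def by (intro CollectI exI[of _ ?a])
  show "four_flow_poly V E ends - ?g \<in> edge_ideal E"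
    using finite_graph.flow_cong_four_flow_poly[OF assms] by (simp add: flow_cong_def)
qed

end
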